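(* Let $\Vert\cdot\Vert$ be a norm on $\mathbb{R}^2$ whose closed unit ball tiles $\mathbb{R}^2$ by translation. Then $m_1(\mathbb{R}^2,\Vert\cdot\Vert)=\frac14$.
   Context: A set $A\subset\mathbb{R}^n$ avoids distance $1$ (for a norm $\Vert\cdot\Vert$) if $\Vert x-y\Vert\neq 1$ for all $x,y\in A$. The density of a measurable set $A\subset\mathbb{R}^n$ is $\delta(A)=\limsup_{R\to\infty}\frac{\operatorname{Vol}(A\cap[-R,R]^n)}{\operatorname{Vol}([-R,R]^n)}$. The number $m_1(\mathbb{R}^n,\Vert\cdot\Vert)$ is the supremum of $\delta(A)$ over all Lebesgue measurable sets $A\subset\mathbb{R}^n$ avoiding distance $1$. A body $K$ tiles $\mathbb{R}^n$ by translation if there is $\Lambda\subset\mathbb{R}^n$ with $\bigcup_{\lambda\in\Lambda}(\lambda+K)=\mathbb{R}^n$ and the interiors of $\lambda+K$, $\lambda'+K$ are disjoint for $\lambda\neq\lambda'$. *)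

theory Defs
  imports "HOL-Analysis.Analysis"
begin

definition is_norm :: "(real^2 \<Rightarrow> real) \<Rightarrow> bool" where
  "is_norm N \<longleftrightarrow>
     (\<forall>x. 0 \<le> N x) \<and> (\<forall>x. N x = 0 \<longleftrightarrow> x = 0) \<and>
     (\<forall>c x. N (c *\<^sub>R x) = \<bar>c\<bar> * N x) \<and>
     (\<forall>x y. N (x + y) \<le> N x + N y)"

definition unit_ball :: "(real^2 \<Rightarrow> real) \<Rightarrow> (real^2) set" where
  "unit_ball N = {x. N x \<le> 1}"

definition tiles_by_translation :: "(real^2) set \<Rightarrow> bool" where
  "tiles_by_translation K \<longleftrightarrow>
     (\<exists>\<Lambda>. (\<Union>l\<in>\<Lambda>. (\<lambda>x. l + x) ` K) = UNIV \<and>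
          (\<forall>l\<in>\<Lambda>. \<forall>l'\<in>\<Lambda>. l \<noteq> l' \<longrightarrow>
              interior ((\<lambda>x. l + x) ` K) \<inter> interior ((\<lambda>x. l' + x) ` K) = {}))"

definition avoids_dist1 :: "(real^2 \<Rightarrow> real) \<Rightarrow> (real^2) set \<Rightarrow> bool" where
  "avoids_dist1 N A \<longleftrightarrow> (\<forall>x\<in>A. \<forall>y\<in>A. N (x - y) \<noteq> 1)"

definition cube :: "real \<Rightarrow> (real^2) set" where
  "cube R = {x. \<forall>i. \<bar>x $ i\<bar> \<le> R}"

definition density :: "(real^2) set \<Rightarrow> ereal" where
  "density A = Limsup at_top
     (\<lambda>R::real. ereal (measure lebesgue (A \<inter> cube R) / measure lebesgue (cube R)))"

definition m1 :: "(real^2 \<Rightarrow> real) \<Rightarrow> ereal" where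
  "m1 N = Sup {density A | A. A \<in> sets lebesgue \<and> avoids_dist1 N A}"

end

theory Submission
  imports Defs "HOL-Real_Asymp.Real_Asymp"
begin

text \<open>
  Lower bound: the centres of a tiling by \<open>K\<close> are at mutual distance at least 2, so the open balls
  of radius 1/2 around them avoid distance 1 and occupy a quarter of the volume.

  Upper bound: the boundary of a tile is connected and covered by finitely many closed neighbouring
  tiles, so some point lies in three tiles. Hence there are \<open>a, b, c\<close> of norm 1 with pairwise
  differences of norm 2, and the six points \<open>\<plusminus>a/2, \<plusminus>b/2, \<plusminus>c/2\<close> are the vertices of a hexagon (possibly
  degenerate) in which any two non-adjacent vertices, i.e. all pairs except \<open>s/2, -t/2\<close>
  with \<open>s \<noteq> t\<close>, are at distance 1. If \<open>B\<close> avoids distance 1, then every translate of the hexagon has at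
  most two vertices in \<open>B\<close>, and if two, they are adjacent: the number of vertices in \<open>B\<close> is at most
  1 plus the number of edges in \<open>B\<close>. Integrating over all translates, the left-hand side becomes
  6 vol \<open>B\<close>. On the right, opposite edges are parallel, and a point of \<open>B\<close> starts at most one of the
  edges \<open>-(a+b)/2, -(b+c)/2, -(a+c)/2\<close>, as their differences have norm 1; so the edges contribute at most
  2 vol \<open>B\<close>, whence 4 vol \<open>B\<close> is at most the volume available.
\<close>

section \<open>Cubes and limits of volume ratios\<close>

lemma cube_eq_cbox: "cube R = cbox (\<chi> i. - R) (\<chi> i. R)"
  by (auto simp: cube_def mem_box_cart abs_le_iff minus_le_iff)

lemma lmeasurable_cube [simp]: "cube R \<in> lmeasurable"
  by (simp add: cube_eq_cbox)

lemma measure_cube: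
  assumes "0 \<le> R"
  shows "measure lebesgue (cube R) = 4 * R\<^sup>2"
proof -
  have "cbox (\<chi> i. - R) (\<chi> i. R) \<noteq> ({} :: (real^2) set)"
    using assms by (auto simp: interval_ne_empty_cart)
  then show ?thesis
    by (simp add: cube_eq_cbox content_cbox_cart power2_eq_square)
qed

lemma cube_add: "x \<in> cube R \<Longrightarrow> y \<in> cube S \<Longrightarrow> x + y \<in> cube (R + S)"
  unfolding cube_def
  by (clarsimp, rule order_trans[OF abs_triangle_ineq]) (intro add_mono; blast)

lemma cube_diff: "x \<in> cube R \<Longrightarrow> y \<in> cube S \<Longrightarrow> x - y \<in> cube (R + S)"
  unfolding cube_def
  by (clarsimp, rule order_trans[OF abs_triangle_ineq4]) (intro add_mono; blast)

lemma half_in_cube: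
  assumes "x \<in> cube R"
  shows "(1/2) *\<^sub>R x \<in> cube R"
  unfolding cube_def
proof (intro CollectI allI)
  fix i
  have "\<bar>x $ i\<bar> \<le> R" using assms by (simp add: cube_def)
  then show "\<bar>((1/2) *\<^sub>R x) $ i\<bar> \<le> R" by simp
qed

lemma bounded_subset_cube:
  assumes "bounded S"
  obtains C where "0 < C" "S \<subseteq> cube C"
proof -
  obtain C where C: "0 < C" "\<And>x. x \<in> S \<Longrightarrow> norm x \<le> C"
    using assms bounded_pos by blast
  then have "S \<subseteq> cube C"
    by (auto simp: cube_def intro: order_trans[OF component_le_norm_cart])
  with C(1) show ?thesis by (rule that)
qed

text \<open>The cube \<open>cube R\<close> has volume \<open>4 * R^2\<close>, and a fixed shift
  \<open>D\<close> of the side is of lower order. Boundary effects of bounded width therefore vanish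
  in the limit, and the factor 4 alone produces the value 1/4.\<close>

lemma density_le_of_bound:
  assumes "\<And>R. 0 < R \<Longrightarrow> measure lebesgue (A \<inter> cube R) \<le> (R + D)\<^sup>2"
  shows "density A \<le> ereal (1/4)"
proof -
  have "density A \<le> Limsup at_top (\<lambda>R. ereal ((R + D)\<^sup>2 / (4 * R\<^sup>2)))"
    unfolding density_def
  proof (rule Limsup_mono)
    show "\<forall>\<^sub>F R in at_top. ereal (measure lebesgue (A \<inter> cube R) / measure lebesgue (cube R))
            \<le> ereal ((R + D)\<^sup>2 / (4 * R\<^sup>2))"
      using eventually_gt_at_top[of 0]
      by eventually_elim (simp add: assms measure_cube divide_right_mono)
  qed
  also have "((\<lambda>R::real. (R + D)\<^sup>2 / (4 * R\<^sup>2)) \<longlongrightarrow> 1/4) at_top"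
    by real_asymp
  then have "Limsup at_top (\<lambda>R. ereal ((R + D)\<^sup>2 / (4 * R\<^sup>2))) = ereal (1/4)"
    by (intro lim_imp_Limsup) auto
  finally show ?thesis .
qed

lemma density_ge_of_bound:
  assumes "\<And>R. D < R \<Longrightarrow> (R - D)\<^sup>2 \<le> measure lebesgue (A \<inter> cube R)"
  shows "ereal (1/4) \<le> density A"
proof -
  have "((\<lambda>R::real. (R - D)\<^sup>2 / (4 * R\<^sup>2)) \<longlongrightarrow> 1/4) at_top"
    by real_asymp
  then have "ereal (1/4) = Limsup at_top (\<lambda>R. ereal ((R - D)\<^sup>2 / (4 * R\<^sup>2)))"
    by (intro lim_imp_Limsup[symmetric]) auto
  also have "\<dots> \<le> density A"
    unfolding density_def
  proof (rule Limsup_mono)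
    show "\<forall>\<^sub>F R in at_top. ereal ((R - D)\<^sup>2 / (4 * R\<^sup>2))
            \<le> ereal (measure lebesgue (A \<inter> cube R) / measure lebesgue (cube R))"
      using eventually_gt_at_top[of 0] eventually_gt_at_top[of D]
      by eventually_elim (simp add: assms measure_cube divide_right_mono)
  qed
  finally show ?thesis .
qed

section \<open>Topology and volume of the balls of a norm\<close>

context
  fixes N :: "real^2 \<Rightarrow> real"
  assumes norm_N: "is_norm N"
begin

lemma N_nonneg [simp]: "0 \<le> N x"
  and N_eq_0_iff [simp]: "N x = 0 \<longleftrightarrow> x = 0"
  and N_scaleR [simp]: "N (c *\<^sub>R x) = \<bar>c\<bar> * N x"
  and N_triangle: "N (x + y) \<le> N x + N y"
  using norm_N by (auto simp: is_norm_def)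

lemma N_zero [simp]: "N 0 = 0"
  by simp

lemma N_minus [simp]: "N (- x) = N x"
  using N_scaleR[of "-1" x] by simp

lemma N_commute: "N (x - y) = N (y - x)"
  using N_minus[of "x - y"] by simp

lemma N_triangle_diff: "N (x - z) \<le> N (x - y) + N (y - z)"
  using N_triangle[of "x - y" "y - z"] by simp

lemma convex_on_N: "convex_on UNIV N"
proof (rule convex_onI)
  fix t :: real and x y :: "real^2"
  assume "0 < t" "t < 1"
  then show "N ((1 - t) *\<^sub>R x + t *\<^sub>R y) \<le> (1 - t) * N x + t * N y"
    using N_triangle[of "(1 - t) *\<^sub>R x" "t *\<^sub>R y"] by simp
qed auto

lemma continuous_on_N: "continuous_on S N"
  using convex_on_continuous[OF open_UNIV convex_on_N] continuous_on_subset by blast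

lemma continuous_on_N_compose [continuous_intros]:
  "continuous_on S f \<Longrightarrow> continuous_on S (\<lambda>x. N (f x))"
  using continuous_on_compose2[OF continuous_on_N[of UNIV]] by blast

text \<open>By compactness \<open>N\<close> attains a positive minimum on the Euclidean unit sphere;
  its reciprocal serves as \<open>C\<close>, by homogeneity.\<close>

lemma norm_le_N: "\<exists>C. \<forall>x. norm x \<le> C * N x"
proof -
  have "compact (sphere (0 :: real^2) 1)" "sphere (0 :: real^2) 1 \<noteq> {}"
    by auto
  then obtain z where z: "norm z = 1" "\<And>y. norm y = 1 \<Longrightarrow> N z \<le> N y"
    using continuous_attains_inf[OF _ _ continuous_on_N] by (metis mem_sphere_0)
  have pos: "0 < N z"
    using z(1) by (metis N_eq_0_iff N_nonneg less_eq_real_def norm_zero zero_neq_one)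
  have "norm x \<le> (1 / N z) * N x" for x
  proof (cases "x = 0")
    case False
    then have "N z \<le> N ((1 / norm x) *\<^sub>R x)"
      by (intro z(2)) simp
    then show ?thesis
      using False pos by (simp add: field_simps)
  qed simp
  then show ?thesis by blast
qed

lemma bounded_N_ball: "bounded {x. N (x - l) \<le> r}"
proof -
  obtain C where C: "\<And>x. norm x \<le> C * N x" using norm_le_N by blast
  \<comment> \<open>\<open>norm_le_N\<close> asserts no sign for \<open>C\<close>; the absolute
    value makes multiplication by it monotone.\<close>
  have "norm (x - l) \<le> \<bar>C\<bar> * r" if "N (x - l) \<le> r" for x
  proof -
    have "norm (x - l) \<le> \<bar>C\<bar> * N (x - l)"
      using C by (rule order_trans) (simp add: mult_right_mono)
    also have "\<dots> \<le> \<bar>C\<bar> * r"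
      using that by (intro mult_left_mono) auto
    finally show ?thesis .
  qed
  then have "{x. N (x - l) \<le> r} \<subseteq> cball l (\<bar>C\<bar> * r)"
    by (auto simp: dist_norm norm_minus_commute)
  then show ?thesis
    using bounded_cball bounded_subset by blast
qed

lemma bounded_unit_ball: "bounded (unit_ball N)"
  using bounded_N_ball[of 0 1] by (simp add: unit_ball_def)

lemma convex_unit_ball: "convex (unit_ball N)"
proof (rule convexI)
  fix x y :: "real^2" and u v :: real
  assume "x \<in> unit_ball N" "y \<in> unit_ball N" "0 \<le> u" "0 \<le> v" "u + v = 1"
  then show "u *\<^sub>R x + v *\<^sub>R y \<in> unit_ball N"
    using N_triangle[of "u *\<^sub>R x" "v *\<^sub>R y"] convex_bound_le[of "N x" 1 "N y" u v]
    by (simp add: unit_ball_def)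
qed

lemma open_N_ball: "open {x. N (x - l) < r}"
  by (intro open_Collect_less continuous_intros)

lemma closed_N_ball: "closed {x. N (x - l) \<le> r}"
  by (intro closed_Collect_le continuous_intros)

lemma translate_unit_ball: "(\<lambda>x. l + x) ` unit_ball N = {x. N (x - l) \<le> 1}"
  by (force simp: unit_ball_def image_iff)

lemma interior_N_ball: "interior {x. N (x - l) \<le> 1} = {x. N (x - l) < 1}"
proof (intro antisym subsetI)
  fix x assume x: "x \<in> interior {x. N (x - l) \<le> 1}"
  show "x \<in> {x. N (x - l) < 1}"
  proof (rule ccontr)
    assume "x \<notin> {x. N (x - l) < 1}"
    then have N1: "N (x - l) \<ge> 1" by simp
    \<comment> \<open>A small radial push outwards keeps an interior point inside the ball, yet it
      multiplies \<open>N (x - l)\<close>, which is at least 1, by \<open>1 + t\<close>.\<close>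
    have "((\<lambda>t. x + t *\<^sub>R (x - l)) \<longlongrightarrow> x + 0 *\<^sub>R (x - l)) (at_right (0::real))"
      by (intro tendsto_intros)
    then have "\<forall>\<^sub>F t in at_right (0::real). x + t *\<^sub>R (x - l) \<in> interior {x. N (x - l) \<le> 1}"
      using x by (intro topological_tendstoD) auto
    then have "\<forall>\<^sub>F t in at_right (0::real). t > 0 \<and> x + t *\<^sub>R (x - l) \<in> {x. N (x - l) \<le> 1}"
      using eventually_at_right_less[of 0]
      by eventually_elim (use interior_subset in blast)
    then obtain t :: real where t: "t > 0" "N (x + t *\<^sub>R (x - l) - l) \<le> 1"
      using eventually_happens[of _ "at_right (0::real)"] by auto
    have "x + t *\<^sub>R (x - l) - l = (1 + t) *\<^sub>R (x - l)"
      by (simp add: algebra_simps)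
    then have "(1 + t) * N (x - l) \<le> 1"
      using t by simp
    moreover have "1 + t \<le> (1 + t) * N (x - l)"
      using t(1) N1 mult_left_mono[of 1 "N (x - l)" "1 + t"] by simp
    ultimately show False using t(1) by linarith
  qed
next
  fix x assume "x \<in> {x. N (x - l) < 1}"
  then show "x \<in> interior {x. N (x - l) \<le> 1}"
    by (intro interiorI[OF open_N_ball[of l 1]]) auto
qed

lemma lmeasurable_unit_ball: "unit_ball N \<in> lmeasurable"
  by (intro measurable_convex convex_unit_ball bounded_unit_ball)

lemma half_ball_eq:
  "{x. N (x - l) < 1/2} = (\<lambda>x. (1/2) *\<^sub>R x + l) ` interior (unit_ball N)"
proof -
  have "interior (unit_ball N) = {x. N x < 1}"
    using interior_N_ball[of 0] by (simp add: unit_ball_def)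
  moreover have "{x. N (x - l) < 1/2} = (\<lambda>x. (1/2) *\<^sub>R x + l) ` {x. N x < 1}"
  proof (intro antisym subsetI)
    fix x assume "x \<in> {x. N (x - l) < 1/2}"
    moreover have "x = (1/2) *\<^sub>R (2 *\<^sub>R (x - l)) + l" by simp
    ultimately show "x \<in> (\<lambda>x. (1/2) *\<^sub>R x + l) ` {x. N x < 1}"
      by (intro image_eqI[where x = "2 *\<^sub>R (x - l)"]) (simp_all only: mem_Collect_eq N_scaleR)
  qed auto
  ultimately show ?thesis by simp
qed

text \<open>Halving lengths in the plane divides area by 4. Passing between the open and the closed
  ball costs nothing, since the frontier of a convex set is negligible.\<close>

lemma measure_half_ball:
  "measure lebesgue {x. N (x - l) < 1/2} = measure lebesgue (unit_ball N) / 4"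
proof -
  have "measure lebesgue (interior (unit_ball N)) = measure lebesgue (unit_ball N)"
    by (intro measure_interior bounded_unit_ball negligible_convex_frontier convex_unit_ball)
  then show ?thesis
    unfolding half_ball_eq measure_lebesgue_affine by (simp add: power2_eq_square)
qed

lemma measure_unit_ball_pos: "0 < measure lebesgue (unit_ball N)"
proof -
  have "0 \<in> interior (unit_ball N)"
    using interior_N_ball[of 0] by (simp add: unit_ball_def)
  then have "\<not> negligible (unit_ball N)"
    using negligible_subset[OF _ interior_subset] open_not_negligible[OF open_interior] by blast
  then show ?thesis
    using lmeasurable_unit_ball
    by (metis fmeasurableD2 fmeasurableD measure_eq_0_null_sets negligible_iff_null_sets
        completion.complete measure_nonneg less_eq_real_def negligible_iff_measure0)
qed

lemma lmeasurable_half_ball: "{x. N (x - l) < 1/2} \<in> lmeasurable"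
proof -
  have "bounded {x. N (x - l) < 1/2}"
    by (rule bounded_subset[OF bounded_N_ball[of l "1/2"]]) auto
  then show ?thesis
    using open_N_ball by (rule lmeasurable_open)
qed

text \<open>The sphere of \<open>N\<close> is the image of the Euclidean circle under radial
  projection, and the circle is connected because the dimension is 2.\<close>

lemma connected_N_sphere: "connected {x. N (x - l) = 1}"
proof -
  have "continuous_on (sphere (0::real^2) 1) (\<lambda>y. l + (1 / N y) *\<^sub>R y)"
    by (intro continuous_intros) (metis N_eq_0_iff mem_sphere_0 norm_zero zero_neq_one)
  moreover have "connected (sphere (0::real^2) 1)"
    by (simp add: connected_sphere_eq)
  ultimately have "connected ((\<lambda>y. l + (1 / N y) *\<^sub>R y) ` sphere 0 1)"
    by (rule connected_continuous_image)
  also have "(\<lambda>y. l + (1 / N y) *\<^sub>R y) ` sphere 0 1 = {x. N (x - l) = 1}"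
  proof (intro antisym subsetI)
    fix x assume "x \<in> (\<lambda>y. l + (1 / N y) *\<^sub>R y) ` sphere 0 1"
    then obtain y where y: "norm y = 1" "x = l + (1 / N y) *\<^sub>R y" by auto
    then have "N y \<noteq> 0" using N_eq_0_iff[of y] by (metis norm_zero zero_neq_one)
    then show "x \<in> {x. N (x - l) = 1}" using y by (simp del: N_eq_0_iff)
  next
    fix x assume x: "x \<in> {x. N (x - l) = 1}"
    define y where "y = (1 / norm (x - l)) *\<^sub>R (x - l)"
    have "x \<noteq> l" using x N_eq_0_iff[of 0] by (auto simp del: N_eq_0_iff)
    then have "norm y = 1" "x = l + (1 / N y) *\<^sub>R y"
      using x by (simp_all add: y_def)
    then show "x \<in> (\<lambda>y. l + (1 / N y) *\<^sub>R y) ` sphere 0 1" by auto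
  qed
  finally show ?thesis .
qed

section \<open>Coverings by unit balls with separated centres\<close>

context
  fixes \<Lambda> :: "(real^2) set"
  assumes cover: "\<exists>l\<in>\<Lambda>. N (x - l) \<le> 1"
    and separated: "l \<in> \<Lambda> \<Longrightarrow> l' \<in> \<Lambda> \<Longrightarrow> l \<noteq> l' \<Longrightarrow> 2 \<le> N (l - l')"
begin

lemma measure_Union_half_balls:
  assumes "finite F" "F \<subseteq> \<Lambda>"
  shows "measure lebesgue (\<Union>l\<in>F. {x. N (x - l) < 1/2}) = card F * (measure lebesgue (unit_ball N) / 4)"
proof -
  have "disjoint_family_on (\<lambda>l. {x. N (x - l) < 1/2}) F"
    unfolding disjoint_family_on_def
  proof (intro ballI impI equals0I)
    fix l l' x
    assume "l \<in> F" "l' \<in> F" "l \<noteq> l'" and x: "x \<in> {x. N (x - l) < 1/2} \<inter> {x. N (x - l') < 1/2}"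
    then have "2 \<le> N (l - l')"
      using assms separated by blast
    then show False
      using x N_triangle_diff[of l l' x] N_commute[of l x] by auto
  qed
  then have "measure lebesgue (\<Union>l\<in>F. {x. N (x - l) < 1/2})
      = (\<Sum>l\<in>F. measure lebesgue {x. N (x - l) < 1/2})"
    using assms(1) lmeasurable_half_ball
    by (intro measure_finite_Union) (auto intro: fmeasurableD fmeasurableD2[THEN notE] simp del: emeasure_completion)
  then show ?thesis
    unfolding measure_half_ball by simp
qed

text \<open>Packing argument: the half balls around centres in \<open>S\<close> are disjoint, have
  equal positive volume and lie in one fixed cube, so comparing volumes bounds their number.\<close>

lemma finite_Int_bounded:
  assumes "bounded S"
  shows "finite (\<Lambda> \<inter> S)"
proof -
  obtain C where C: "unit_ball N \<subseteq> cube C"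
    using bounded_subset_cube[OF bounded_unit_ball] by blast
  obtain R where R: "S \<subseteq> cube R"
    using bounded_subset_cube[OF assms] by blast
  define m where "m = measure lebesgue (unit_ball N) / 4"
  have m: "0 < m" using measure_unit_ball_pos by (simp add: m_def)
  have "card F \<le> nat \<lceil>measure lebesgue (cube (R + C)) / m\<rceil>" if F: "F \<subseteq> \<Lambda> \<inter> S" "finite F" for F
  proof -
    have "(\<Union>l\<in>F. {x. N (x - l) < 1/2}) \<subseteq> cube (R + C)"
    proof
      fix x assume "x \<in> (\<Union>l\<in>F. {x. N (x - l) < 1/2})"
      then obtain l where "l \<in> cube R" "x - l \<in> cube C"
        using F C R by (force simp: unit_ball_def)
      then show "x \<in> cube (R + C)"
        using cube_add[of l R "x - l" C] by simp
    qed
    then have "measure lebesgue (\<Union>l\<in>F. {x. N (x - l) < 1/2}) \<le> measure lebesgue (cube (R + C))"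
      using lmeasurable_half_ball F(2)
      by (intro measure_mono_fmeasurable) (auto intro!: sets.finite_UN fmeasurableD)
    then have "real (card F) * m \<le> measure lebesgue (cube (R + C))"
      using measure_Union_half_balls[of F] F by (simp add: m_def)
    then have "real (card F) \<le> measure lebesgue (cube (R + C)) / m"
      using m by (simp add: field_simps)
    then show ?thesis
      by linarith
  qed
  then show ?thesis
    using finite_if_finite_subsets_card_bdd by blast
qed

lemma density_Union_half_balls:
  "ereal (1/4) \<le> density (\<Union>l\<in>\<Lambda>. {x. N (x - l) < 1/2})" (is "_ \<le> density ?A")
proof -
  obtain C where C: "0 < C" "unit_ball N \<subseteq> cube C"
    using bounded_subset_cube[OF bounded_unit_ball] by blast
  have "(R - 2 * C)\<^sup>2 \<le> measure lebesgue (?A \<inter> cube R)" if R: "2 * C < R" for R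
  proof -
    \<comment> \<open>The margin \<open>C\<close> is spent twice: a tile meeting
      \<open>cube (R - 2 * C)\<close> has its centre in \<open>cube (R - C)\<close>, and the half
      ball around such a centre stays in \<open>cube R\<close>. So the tiles of \<open>F\<close>
      cover the small cube, while their half balls, each a quarter of a tile, fit into the large
      one.\<close>
    define F where "F = \<Lambda> \<inter> cube (R - C)"
    have F: "finite F" "F \<subseteq> \<Lambda>"
      unfolding F_def by (auto intro!: finite_Int_bounded simp: cube_eq_cbox)
    have "cube (R - 2 * C) \<subseteq> (\<Union>l\<in>F. (+) l ` unit_ball N)"
    proof
      fix x assume x: "x \<in> cube (R - 2 * C)"
      obtain l where l: "l \<in> \<Lambda>" "N (x - l) \<le> 1"
        using cover by blast
      then have "x - l \<in> cube C"
        using C by (auto simp: unit_ball_def)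
      then have "l \<in> cube (R - C)"
        using cube_diff[OF x, of "x - l" C] by simp
      then show "x \<in> (\<Union>l\<in>F. (+) l ` unit_ball N)"
        using l by (auto simp: F_def translate_unit_ball)
    qed
    then have "measure lebesgue (cube (R - 2 * C)) \<le> measure lebesgue (\<Union>l\<in>F. (+) l ` unit_ball N)"
      using F lmeasurable_unit_ball
      by (intro measure_mono_fmeasurable) (auto intro!: fmeasurable.finite_UN measurable_translation fmeasurableD)
    also have "\<dots> \<le> (\<Sum>l\<in>F. measure lebesgue ((+) l ` unit_ball N))"
      using F lmeasurable_unit_ball
      by (intro measure_UNION_le) (auto intro!: measurable_translation fmeasurableD)
    also have "\<dots> = 4 * measure lebesgue (\<Union>l\<in>F. {x. N (x - l) < 1/2})"
      unfolding measure_Union_half_balls[OF F] by (simp add: measure_translation)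
    also have "measure lebesgue (\<Union>l\<in>F. {x. N (x - l) < 1/2}) \<le> measure lebesgue (?A \<inter> cube R)"
    proof (intro measure_mono_fmeasurable)
      show "(\<Union>l\<in>F. {x. N (x - l) < 1/2}) \<subseteq> ?A \<inter> cube R"
      proof
        fix x assume "x \<in> (\<Union>l\<in>F. {x. N (x - l) < 1/2})"
        then obtain l where l: "l \<in> \<Lambda>" "l \<in> cube (R - C)" "N (x - l) < 1/2"
          by (auto simp: F_def)
        then have "x - l \<in> cube C" using C by (auto simp: unit_ball_def)
        then have "x \<in> cube R"
          using cube_add[OF l(2), of "x - l" C] by simp
        then show "x \<in> ?A \<inter> cube R" using l by blast
      qed
      show "(\<Union>l\<in>F. {x. N (x - l) < 1/2}) \<in> sets lebesgue"
        using F lmeasurable_half_ball by (auto intro!: sets.finite_UN fmeasurableD)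
      have "open ?A" by (intro open_UN ballI open_N_ball)
      then have "?A \<in> sets lebesgue" by (simp add: borel_open)
      then show "?A \<inter> cube R \<in> lmeasurable"
        by (subst Int_commute) (rule fmeasurable_Int_fmeasurable[OF lmeasurable_cube])
    qed
    finally show ?thesis
      using R C by (simp add: measure_cube)
  qed
  then show ?thesis by (rule density_ge_of_bound)
qed

text \<open>The vectors lead from the centres of three tiles to a common point. They have norm at
  most 1 while the centres are at least 2 apart, so the triangle inequality forces equality
  everywhere.\<close>

lemma three_equidistant_points:
  obtains a b c where "N a = 1" "N b = 1" "N c = 1" "N (a - b) = 2" "N (b - c) = 2" "N (c - a) = 2"
proof -
  obtain l0 where l0: "l0 \<in> \<Lambda>" using cover by blast
  \<comment> \<open>Points slightly outside the tile of \<open>l0\<close> are within 2 of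
    \<open>l0\<close> and within 1 of the centre of a tile covering them; this gives the radius
    3.\<close>
  define F where "F = {l \<in> \<Lambda>. l \<noteq> l0 \<and> N (l - l0) \<le> 3}"
  define S where "S = {x. N (x - l0) = 1}"
  define T where "T l = {x. N (x - l) \<le> 1}" for l
  have "finite (\<Lambda> \<inter> {x. N (x - l0) \<le> 3})"
    by (intro finite_Int_bounded bounded_N_ball)
  then have "finite F" by (rule finite_subset[rotated]) (auto simp: F_def)
  have closed_T: "closed (T l)" for l
    unfolding T_def by (rule closed_N_ball)
  have S_sub: "S \<subseteq> (\<Union>l\<in>F. T l)"
  proof
    fix x assume x: "x \<in> S"
    \<comment> \<open>A point of \<open>S\<close> lies in the tile of \<open>l0\<close> itself, so
      \<open>cover\<close> alone need not yield another tile. The points \<open>y n\<close> approach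
      it from outside that tile, and the finite union of closed neighbours contains the
      limit.\<close>
    define y where "y n = l0 + (1 + inverse (real (Suc n))) *\<^sub>R (x - l0)" for n
    have y_in: "y n \<in> (\<Union>l\<in>F. T l)" for n
    proof -
      have Ny: "N (y n - l0) = 1 + inverse (real (Suc n))"
        using x by (simp add: y_def S_def)
      obtain l where l: "l \<in> \<Lambda>" "N (y n - l) \<le> 1" using cover by blast
      have "inverse (real (Suc n)) \<le> 1" "inverse (real (Suc n)) > 0"
        by (auto simp: field_simps)
      then have "l \<noteq> l0" "N (l - l0) \<le> 3"
        using Ny l N_triangle_diff[of l l0 "y n"] N_commute[of l "y n"] by auto
      then show ?thesis using l by (auto simp: F_def T_def)
    qed
    have "y \<longlonglongrightarrow> l0 + (1 + 0) *\<^sub>R (x - l0)"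
      unfolding y_def by (intro tendsto_intros LIMSEQ_inverse_real_of_nat)
    then have "y \<longlonglongrightarrow> x" by simp
    moreover have "closed (\<Union>l\<in>F. T l)"
      using \<open>finite F\<close> closed_T by (intro closed_UN) auto
    ultimately show "x \<in> (\<Union>l\<in>F. T l)"
      using y_in closed_sequentially by blast
  qed
  \<comment> \<open>The point of \<open>S\<close> opposite to \<open>l\<close> is at distance
    \<open>1 + N d\<close> from \<open>l\<close>.\<close>
  have not_sub: "\<not> S \<subseteq> T l" if "l \<in> F" for l
  proof
    assume "S \<subseteq> T l"
    define d where "d = l - l0"
    have d: "2 \<le> N d" using that separated l0 by (auto simp: d_def F_def)
    then have "d \<noteq> 0" by auto
    then have "l0 - (1 / N d) *\<^sub>R d \<in> S"
      using N_minus[of "(1 / N d) *\<^sub>R d"] by (simp add: S_def)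
    then have "l0 - (1 / N d) *\<^sub>R d \<in> T l" using \<open>S \<subseteq> T l\<close> by blast
    moreover have "l0 - (1 / N d) *\<^sub>R d - l = - ((1 / N d + 1) *\<^sub>R d)"
      by (simp add: d_def algebra_simps)
    ultimately have "(1 / N d + 1) * N d \<le> 1"
      by (simp add: T_def)
    then have "1 + N d \<le> 1" using \<open>d \<noteq> 0\<close> by (simp add: distrib_right)
    then show False using d by linarith
  qed
  have "0 \<noteq> (axis 1 1 :: real^2)" by (simp add: axis_eq_0_iff)
  then obtain e :: "real^2" where "e \<noteq> 0" by metis
  then have "l0 + (1 / N e) *\<^sub>R e \<in> S" by (simp add: S_def)
  then obtain p l where p: "p \<in> S" "l \<in> F" "p \<in> T l" using S_sub by blast
  \<comment> \<open>Otherwise \<open>T l\<close> and the union of the other neighbours would split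
    the connected set \<open>S\<close> into disjoint closed pieces. As \<open>T l\<close> meets
    \<open>S\<close>, it would contain all of \<open>S\<close>.\<close>
  have "\<exists>m\<in>F - {l}. T l \<inter> T m \<inter> S \<noteq> {}"
  proof (rule ccontr)
    assume "\<not> ?thesis"
    then have "T l \<inter> (\<Union>m\<in>F - {l}. T m) \<inter> S = {}" by blast
    moreover have "S \<subseteq> T l \<union> (\<Union>m\<in>F - {l}. T m)" using S_sub by blast
    moreover have "closed (\<Union>m\<in>F - {l}. T m)"
      using \<open>finite F\<close> closed_T by (intro closed_UN) auto
    moreover have "connected S"
      unfolding S_def by (rule connected_N_sphere)
    ultimately have "(\<Union>m\<in>F - {l}. T m) \<inter> S = {}"
      using connected_closedD[of S "T l" "\<Union>m\<in>F - {l}. T m"] closed_T p by blast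
    then show False using \<open>S \<subseteq> T l \<union> _\<close> not_sub[OF p(2)] by blast
  qed
  then obtain m x where m: "m \<in> F" "m \<noteq> l" and x: "N (x - l0) = 1" "N (x - l) \<le> 1" "N (x - m) \<le> 1"
    by (auto simp: S_def T_def)
  have sep: "2 \<le> N (l - l0)" "2 \<le> N (m - l)" "2 \<le> N (l0 - m)"
    using p(2) m l0 by (auto simp: F_def intro!: separated)
  have tri: "N (l - l0) \<le> N (x - l0) + N (x - l)" "N (m - l) \<le> N (x - l) + N (x - m)"
    "N (l0 - m) \<le> N (x - m) + N (x - l0)"
    using N_triangle_diff[of l l0 x] N_triangle_diff[of m l x] N_triangle_diff[of l0 m x]
    by (simp_all add: N_commute)
  have "N (x - l0) = 1" "N (x - l) = 1" "N (x - m) = 1" "N (l - l0) = 2" "N (m - l) = 2" "N (l0 - m) = 2"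
    using sep tri x by linarith+
  then show ?thesis
    by (intro that[of "x - l0" "x - l" "x - m"]) (simp_all add: algebra_simps)
qed

end

section \<open>The hexagon inequality for sets avoiding distance 1\<close>

lemma measure_le_of_three_points:
  assumes abc: "N a = 1" "N b = 1" "N c = 1" "N (a - b) = 2" "N (b - c) = 2" "N (c - a) = 2"
    and D: "a \<in> cube D" "b \<in> cube D" "c \<in> cube D"
    and B: "B \<in> lmeasurable" "B \<subseteq> cube R" "avoids_dist1 N B"
  shows "4 * measure lebesgue B \<le> measure lebesgue (cube (R + D))"
proof -
  \<comment> \<open>\<open>T h\<close> collects the positions \<open>z\<close> at which the vertex
    \<open>z + h\<close> of the translated hexagon falls into \<open>B\<close>; below,
    \<open>P s\<close> and \<open>M s\<close> do this for the vertices s/2 and -s/2.\<close>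
  define T where "T h = {z. z + h \<in> B}" for h
  have T_eq: "T h = (+) (- h) ` B" for h
    by (force simp: T_def image_iff algebra_simps)
  have T_lm [simp]: "T h \<in> lmeasurable" and T_measure [simp]: "measure lebesgue (T h) = measure lebesgue B" for h
    by (simp_all add: T_eq measurable_translation_subtract measure_translation_subtract B(1))
  have T_excl: "z \<in> T h \<Longrightarrow> z \<in> T k \<Longrightarrow> N (h - k) = 1 \<Longrightarrow> False" for z h k
    using B(3) unfolding avoids_dist1_def T_def
    by (metis add_diff_cancel_left mem_Collect_eq)
  define P where "P s = T ((1/2) *\<^sub>R s)" for s
  define M where "M s = T (- ((1/2) *\<^sub>R s))" for s
  \<comment> \<open>The starting points in \<open>B\<close> of edges with both ends in
    \<open>B\<close>. Only \<open>s + t\<close> matters, so the opposite edges from s/2 to -t/2 and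
    from t/2 to -s/2 share one set.\<close>
  define E where "E s t = B \<inter> T (- ((1/2) *\<^sub>R (s + t)))" for s t
  have half: "N ((1/2) *\<^sub>R s - (1/2) *\<^sub>R t) = N (s - t) / 2" for s t
    using N_scaleR[of "1/2" "s - t"] by (simp add: scaleR_diff_right)
  have PP: "\<not> (z \<in> P s \<and> z \<in> P t)" if "N (s - t) = 2" for z s t
    using T_excl[of z "(1/2) *\<^sub>R s" "(1/2) *\<^sub>R t"] half[of s t] that by (auto simp: P_def)
  have MM: "\<not> (z \<in> M s \<and> z \<in> M t)" if "N (s - t) = 2" for z s t
    using T_excl[of z "- ((1/2) *\<^sub>R t)" "- ((1/2) *\<^sub>R s)"] half[of s t] that by (auto simp: M_def)
  have PM: "\<not> (z \<in> P s \<and> z \<in> M s)" if "N s = 1" for z s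
    using T_excl[of z "(1/2) *\<^sub>R s" "- ((1/2) *\<^sub>R s)"] that
    by (auto simp: P_def M_def simp flip: scaleR_add_left)
  have PM_eq: "P s \<inter> M t = (+) (- ((1/2) *\<^sub>R s)) ` E s t" for s t
    by (force simp: P_def M_def E_def T_def image_iff algebra_simps)
  have E_lm [simp]: "E s t \<in> lmeasurable" for s t
    by (simp add: E_def B(1) fmeasurable.Int)
  have PM_measure: "measure lebesgue (P s \<inter> M t) = measure lebesgue (E s t)" for s t
    by (simp only: PM_eq measure_translation)
  have E_commute: "E s t = E t s" for s t by (simp add: E_def add.commute)
  \<comment> \<open>The end points of two such edges from a common start differ by (t - u)/2, of
    norm 1, so they cannot both lie in \<open>B\<close>.\<close>
  have E_disj: "E s t \<inter> E s u = {}" if "N (t - u) = 2" for s t u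
  proof -
    define h k where "h = - ((1/2) *\<^sub>R (s + u))" and "k = - ((1/2) *\<^sub>R (s + t))"
    have "h - k = (1/2) *\<^sub>R (t - u)"
      by (simp add: h_def k_def vec_eq_iff field_simps)
    then have "N (h - k) = 1"
      using that by (simp only: N_scaleR)
    then have "\<not> (z \<in> T h \<and> z \<in> T k)" for z
      using T_excl[of z h k] by blast
    then show ?thesis
      by (auto simp: E_def h_def k_def)
  qed
  let ?I = "\<lambda>S. indicat_real S" and ?m = "measure lebesgue"
  have int [simp]: "S \<in> lmeasurable \<Longrightarrow> integrable lebesgue (?I S)" for S :: "(real^2) set"
    by (simp add: lmeasurable_iff_integrable)
  have lm [simp]: "P s \<in> lmeasurable" "M s \<in> lmeasurable" "P s \<inter> M t \<in> lmeasurable" for s t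
    by (simp_all add: P_def M_def fmeasurable.Int)
  have "E a b \<inter> E b c = {}" "E a b \<inter> E a c = {}" "E b c \<inter> E a c = {}"
    using E_disj[of c a b] E_disj[of b c a] E_disj[of a b c] abc
    unfolding E_commute[of b a] E_commute[of c a] E_commute[of c b] by blast+
  then have "?I (E a b) z + ?I (E b c) z + ?I (E a c) z \<le> ?I B z" for z
    by (auto simp: indicator_def E_def)
  then have "(\<integral>z. ?I (E a b) z + ?I (E b c) z + ?I (E a c) z \<partial>lebesgue) \<le> (\<integral>z. ?I B z \<partial>lebesgue)"
    by (intro integral_mono) (simp_all add: B(1))
  then have E_le: "?m (E a b) + ?m (E b c) + ?m (E a c) \<le> ?m B"
    by simp
  have in_cube: "z \<in> cube (R + D)" if "z \<in> P s \<or> z \<in> M s" "s \<in> {a, b, c}" for z s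
  proof -
    have "(1/2) *\<^sub>R s \<in> cube D"
      using that(2) D half_in_cube by blast
    then show ?thesis
      using that(1) B(2) cube_diff[of "z + (1/2) *\<^sub>R s" R "(1/2) *\<^sub>R s" D] cube_add[of "z - (1/2) *\<^sub>R s" R "(1/2) *\<^sub>R s" D]
      by (auto simp: P_def M_def T_def)
  qed
  \<comment> \<open>The exclusions leave at most one \<open>P\<close> and one \<open>M\<close>
    containing \<open>z\<close>, with different labels if both occur. So the left side is at most 2,
    and when it is 2 exactly one edge term compensates; the cube term supplies the 1.\<close>
  have "?I (P a) z + ?I (P b) z + ?I (P c) z + ?I (M a) z + ?I (M b) z + ?I (M c) z
      \<le> ?I (cube (R + D)) z + ?I (P a \<inter> M b) z + ?I (P b \<inter> M a) z + ?I (P b \<inter> M c) z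
         + ?I (P c \<inter> M b) z + ?I (P a \<inter> M c) z + ?I (P c \<inter> M a) z" for z
  proof -
    note PP[OF abc(4), of z] PP[OF abc(5), of z] PP[OF abc(6), of z]
      MM[OF abc(4), of z] MM[OF abc(5), of z] MM[OF abc(6), of z]
      PM[OF abc(1), of z] PM[OF abc(2), of z] PM[OF abc(3), of z]
    moreover have "z \<in> cube (R + D)" if "z \<in> P a \<or> z \<in> P b \<or> z \<in> P c \<or> z \<in> M a \<or> z \<in> M b \<or> z \<in> M c"
      using that in_cube by blast
    ultimately show ?thesis
      unfolding indicator_def Int_iff
      by (cases "z \<in> P a"; cases "z \<in> P b"; cases "z \<in> P c"; cases "z \<in> M a"; cases "z \<in> M b";
          cases "z \<in> M c") simp_all
  qed
  then have "(\<integral>z. ?I (P a) z + ?I (P b) z + ?I (P c) z + ?I (M a) z + ?I (M b) z + ?I (M c) z \<partial>lebesgue)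
      \<le> (\<integral>z. ?I (cube (R + D)) z + ?I (P a \<inter> M b) z + ?I (P b \<inter> M a) z + ?I (P b \<inter> M c) z
         + ?I (P c \<inter> M b) z + ?I (P a \<inter> M c) z + ?I (P c \<inter> M a) z \<partial>lebesgue)"
    by (intro integral_mono) (simp_all del: indicator_inter_arith)
  \<comment> \<open>Each \<open>E\<close> is counted twice, once for each of two opposite edges; by
    \<open>E_le\<close> the edges then absorb two of the six copies of \<open>B\<close>.\<close>
  then have "6 * ?m B \<le> ?m (cube (R + D)) + 2 * (?m (E a b) + ?m (E b c) + ?m (E a c))"
    using E_commute[of b a] E_commute[of c b] E_commute[of c a]
    by (simp add: PM_measure) (simp add: P_def M_def)
  then show ?thesis using E_le by simp
qed

section \<open>From tilings to the value 1/4\<close>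

text \<open>Distances within one half ball are below 1, and distances between different ones exceed
  2 - 1/2 - 1/2 = 1; the balls being open makes both bounds strict.\<close>

lemma avoids_dist1_Union_half_balls:
  assumes "\<And>l l'. l \<in> \<Lambda> \<Longrightarrow> l' \<in> \<Lambda> \<Longrightarrow> l \<noteq> l' \<Longrightarrow> 2 \<le> N (l - l')"
  shows "avoids_dist1 N (\<Union>l\<in>\<Lambda>. {x. N (x - l) < 1/2})"
  unfolding avoids_dist1_def
proof (intro ballI notI)
  fix x y
  assume "x \<in> (\<Union>l\<in>\<Lambda>. {x. N (x - l) < 1/2})" "y \<in> (\<Union>l\<in>\<Lambda>. {x. N (x - l) < 1/2})"
  then obtain l l' where l: "l \<in> \<Lambda>" "N (x - l) < 1/2" and l': "l' \<in> \<Lambda>" "N (y - l') < 1/2"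
    by blast
  assume xy: "N (x - y) = 1"
  show False
  proof (cases "l = l'")
    case True
    then show False
      using N_triangle_diff[of x y l] N_commute[of l y] l l' xy by simp
  next
    case False
    then have "2 \<le> N (l - l')" using assms l l' by blast
    then show False
      using N_triangle_diff[of l l' x] N_triangle_diff[of x l' y] N_commute[of l x] l l' xy by linarith
  qed
qed

text \<open>If the centres were closer than 2, their midpoint would be interior to both
  tiles.\<close>

lemma separated_of_disjoint_interiors:
  assumes "interior ((\<lambda>x. l + x) ` unit_ball N) \<inter> interior ((\<lambda>x. l' + x) ` unit_ball N) = {}"
  shows "2 \<le> N (l - l')"
proof (rule ccontr)
  assume "\<not> 2 \<le> N (l - l')"
  moreover define x where "x = (1/2) *\<^sub>R (l + l')"
  have "x - l = (- 1/2) *\<^sub>R (l - l')" "x - l' = (1/2) *\<^sub>R (l - l')"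
    by (simp_all add: x_def vec_eq_iff field_simps)
  ultimately have "N (x - l) < 1" "N (x - l') < 1"
    by simp_all
  then show False
    using assms unfolding translate_unit_ball interior_N_ball by blast
qed

lemma density_le_quarter:
  assumes abc: "N a = 1" "N b = 1" "N c = 1" "N (a - b) = 2" "N (b - c) = 2" "N (c - a) = 2"
    and A: "A \<in> sets lebesgue" "avoids_dist1 N A"
  shows "density A \<le> ereal (1/4)"
proof -
  \<comment> \<open>\<open>D\<close> bounds the hexagon, so every position at which it has a vertex
    in \<open>cube R\<close> lies in \<open>cube (R + D)\<close>.\<close>
  obtain D where D: "0 < D" "{a, b, c} \<subseteq> cube D"
    using bounded_subset_cube[of "{a, b, c}"] by auto
  have "measure lebesgue (A \<inter> cube R) \<le> (R + D)\<^sup>2" if "0 < R" for R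
  proof -
    have "A \<inter> cube R \<in> lmeasurable"
      using A(1) fmeasurable_Int_fmeasurable[OF lmeasurable_cube] by (simp add: Int_commute)
    moreover have "avoids_dist1 N (A \<inter> cube R)"
      using A(2) by (simp add: avoids_dist1_def)
    ultimately have "4 * measure lebesgue (A \<inter> cube R) \<le> measure lebesgue (cube (R + D))"
      using abc D by (intro measure_le_of_three_points[of a b c]) auto
    then show ?thesis
      using that D by (simp add: measure_cube)
  qed
  then show ?thesis by (rule density_le_of_bound)
qed

end

theorem theorem1:
  fixes N :: "real^2 \<Rightarrow> real"
  assumes "is_norm N"
    and "tiles_by_translation (unit_ball N)"
  shows "m1 N = ereal (1/4)"
proof -
  obtain \<Lambda> where tiling: "(\<Union>l\<in>\<Lambda>. (\<lambda>x. l + x) ` unit_ball N) = UNIV"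
    "\<forall>l\<in>\<Lambda>. \<forall>l'\<in>\<Lambda>. l \<noteq> l' \<longrightarrow>
      interior ((\<lambda>x. l + x) ` unit_ball N) \<inter> interior ((\<lambda>x. l' + x) ` unit_ball N) = {}"
    using assms(2) by (auto simp: tiles_by_translation_def)
  have cover: "\<exists>l\<in>\<Lambda>. N (x - l) \<le> 1" for x
    using tiling(1) unfolding translate_unit_ball[OF assms(1)] by blast
  have sep: "2 \<le> N (l - l')" if "l \<in> \<Lambda>" "l' \<in> \<Lambda>" "l \<noteq> l'" for l l'
    using tiling(2) that by (intro separated_of_disjoint_interiors[OF assms(1)]) auto
  obtain a b c where abc: "N a = 1" "N b = 1" "N c = 1" "N (a - b) = 2" "N (b - c) = 2" "N (c - a) = 2"
    using three_equidistant_points[OF assms(1) cover sep] by blast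
  let ?A = "\<Union>l\<in>\<Lambda>. {x. N (x - l) < 1/2}"
  have "open ?A"
    by (intro open_UN ballI open_N_ball[OF assms(1)])
  then have "?A \<in> sets lebesgue" by (simp add: borel_open)
  moreover have "avoids_dist1 N ?A"
    by (intro avoids_dist1_Union_half_balls[OF assms(1)] sep)
  ultimately have "density ?A \<le> m1 N"
    unfolding m1_def by (intro Sup_upper) blast
  moreover have "ereal (1/4) \<le> density ?A"
    by (intro density_Union_half_balls[OF assms(1)] cover sep)
  moreover have "m1 N \<le> ereal (1/4)"
    unfolding m1_def using density_le_quarter[OF assms(1) abc] by (intro Sup_least) blast
  ultimately show ?thesis by (meson antisym order_trans)
qed

end
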